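(* Let $\mathcal F=(G_\alpha,d_\alpha,\varepsilon_\alpha)_{\alpha\in I}$ be an approximating family, let $\ell\geqslant 0$, $m\geqslant 1$, and fix elements $a_1^\alpha,\ldots,a_\ell^\alpha\in G_\alpha$ for each $\alpha\in I$. Let $W\subseteq\mathbb F_\ell\ast\mathbb F_m$ be a finite subset and $G=\mathbb F_\ell\ast\mathbb F_m/\langle W\rangle$, with $a_i,x_j\in G$ the images of $\bar a_i,\bar x_j$. Then $G$ is constraint $\mathcal F$-stable with respect to $a_1^\alpha,\ldots,a_\ell^\alpha\in G_\alpha$, $\alpha\in I$, if and only if, for every non-principal ultrafilter $\omega$ over $\mathbb N$ and any function $f\colon\mathbb N\to I$, every group homomorphism $\theta\colon G\to\prod_{k\to\omega}(G_{f(k)},d_{f(k)})$ such that $\theta(a_i)=\prod_{k\to\omega}a_i^{f(k)}$ for each $i=1,\ldots,\ell$ is constraint liftable with respect to $a_1^\alpha,\ldots,a_\ell^\alpha\in G_\alpha$, $\alpha\in I$.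
   Context: An approximating family $\mathcal F=(G_\alpha,d_\alpha,\varepsilon_\alpha)_{\alpha\in I}$, indexed by an arbitrary set $I$, consists of groups $G_\alpha$ with identity $1_\alpha$, bi-invariant distances $d_\alpha$ on $G_\alpha$, and real numbers $\varepsilon_\alpha>0$ with $\inf_{\alpha\in I}\varepsilon_\alpha>0$. $\mathbb F_\ell$ is the free group on $\bar a_1,\ldots,\bar a_\ell$ and $\mathbb F_m$ the free group on $\bar x_1,\ldots,\bar x_m$. For $w\in\mathbb F_\ell\ast\mathbb F_m$ and elements $a_i,h_j$ of a group $H$, $w(a_1,\ldots,a_\ell,h_1,\ldots,h_m)$ is the image of $w$ under the homomorphism $\bar a_i\mapsto a_i$, $\bar x_j\mapsto h_j$. $\langle W\rangle$ is the normal subgroup of $\mathbb F_\ell\ast\mathbb F_m$ generated by $W$. Elements $h_1,\ldots,h_m\in G_\alpha$ are a solution (respectively, for $\delta>0$, a $\delta$-solution) of $W$ in $G_\alpha$ with coefficients $a_1^\alpha,\ldots,a_\ell^\alpha$ if $w(a_1^\alpha,\ldots,a_\ell^\alpha,h_1,\ldots,h_m)=1_\alpha$ (respectively $d_\alpha(w(a_1^\alpha,\ldots,a_\ell^\alpha,h_1,\ldots,h_m),1_\alpha)<\delta$) for all $w\in W$. The group $G=\mathbb F_\ell\ast\mathbb F_m/\langle W\rangle$ is constraint $\mathcal F$-stable with respect to $a_1^\alpha,\ldots,a_\ell^\alpha\in G_\alpha$, $\alpha\in I$, if for every $\varepsilon>0$ there is $\delta>0$ such that for every $\alpha\in I$ and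 every $\delta$-solution $g_1,\ldots,g_m\in G_\alpha$ of $W$ with coefficients $a_1^\alpha,\ldots,a_\ell^\alpha$ there is a solution $\tilde g_1,\ldots,\tilde g_m\in G_\alpha$ of $W$ with coefficients $a_1^\alpha,\ldots,a_\ell^\alpha$ such that $d_\alpha(g_i,\tilde g_i)<\varepsilon$ for all $i$. For a non-principal ultrafilter $\omega$ over $\mathbb N$ and $f\colon\mathbb N\to I$, the metric ultraproduct $\prod_{k\to\omega}(G_{f(k)},d_{f(k)})$ is the quotient of $\prod_{k\in\mathbb N}G_{f(k)}$ by the normal subgroup of all $(g_k)_k$ with $\lim_{k\to\omega}d_{f(k)}(g_k,1_{f(k)})=0$; the class of $(g_k)_k$ is written $\prod_{k\to\omega}g_k$. A (not necessarily injective) homomorphism $\theta\colon G\to\prod_{k\to\omega}(G_{f(k)},d_{f(k)})$ with $\theta(a_i)=\prod_{k\to\omega}a_i^{f(k)}$, $i=1,\ldots,\ell$, is constraint liftable with respect to $a_1^\alpha,\ldots,a_\ell^\alpha\in G_\alpha$, $\alpha\in I$, if for each $k\in\mathbb N$ there exist $g_1^k,\ldots,g_m^k\in G_{f(k)}$ such that $g_1^k,\ldots,g_m^k$ are a solution of $W$ in $G_{f(k)}$ with coefficients $a_1^{f(k)},\ldots,a_\ell^{f(k)}$ and $\theta(x_j)=\prod_{k\to\omega}g_j^k$ for each $j=1,\ldots,m$. (The homomorphism $\tilde\theta\colon G\to\prod_{k\in\mathbb N}G_{f(k)}$ with $\tilde\theta(a_i)=(a_i^{f(k)})_{k\in\mathbb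 N}$ and $\tilde\theta(x_j)=(g_j^k)_{k\in\mathbb N}$ is then called a constraint lift of $\theta$.)
   Formalization: The claim fails for stable W solvable in some but not all G_α. The equivalence is proved assuming that solvability of W in one G_α implies it in all; and, without this assumption, with a lift required to satisfy the equations only for ω-almost all k. *)

theory Defs
  imports "HOL-Analysis.Analysis" "HOL-Algebra.Product_Groups"
begin

section \<open>Free groups\<close>

text \<open>Elements of the free group are reduced words; the letter \<open>(True, s)\<close> stands for the generator
  \<open>s\<close> and \<open>(False, s)\<close> for its inverse.\<close>

type_synonym 'a word = "(bool \<times> 'a) list"

fun reduced :: "'a word \<Rightarrow> bool" where
  "reduced (p # q # w) \<longleftrightarrow> q \<noteq> (\<not> fst p, snd p) \<and> reduced (q # w)"
| "reduced _ \<longleftrightarrow> True"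

fun letter_mult :: "bool \<times> 'a \<Rightarrow> 'a word \<Rightarrow> 'a word" where
  "letter_mult p [] = [p]"
| "letter_mult p (q # w) = (if q = (\<not> fst p, snd p) then w else p # q # w)"

definition free_group :: "'a set \<Rightarrow> 'a word monoid" where
  "free_group S = \<lparr>carrier = {w. reduced w \<and> snd ` set w \<subseteq> S},
                   monoid.mult = (\<lambda>u v. foldr letter_mult u v),
                   one = []\<rparr>"

definition gen :: "'a \<Rightarrow> 'a word" where
  "gen s = [(True, s)]"

text \<open>The value at \<open>w\<close> of the homomorphism from the free group to \<open>H\<close> that extends \<open>\<phi>\<close>.\<close>

primrec word_value :: "('g, 'b) monoid_scheme \<Rightarrow> ('a \<Rightarrow> 'g) \<Rightarrow> 'a word \<Rightarrow> 'g" where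
  "word_value H \<phi> [] = \<one>\<^bsub>H\<^esub>"
| "word_value H \<phi> (p # w) =
     (if fst p then \<phi> (snd p) else inv\<^bsub>H\<^esub> (\<phi> (snd p))) \<otimes>\<^bsub>H\<^esub> word_value H \<phi> w"

lemma reduced_tl: "reduced (p # w) \<Longrightarrow> reduced w"
  by (cases w) auto

lemma reduced_letter_mult: "reduced w \<Longrightarrow> reduced (letter_mult p w)"
  by (cases w) (auto dest: reduced_tl)

lemma reduced_foldr: "reduced v \<Longrightarrow> reduced (foldr letter_mult u v)"
  by (induction u) (auto intro: reduced_letter_mult)

lemma set_letter_mult: "set (letter_mult p w) \<subseteq> insert p (set w)"
  by (cases w) auto

lemma set_foldr: "set (foldr letter_mult u v) \<subseteq> set u \<union> set v"
  by (induction u) (use set_letter_mult in fastforce)+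

lemma letter_mult_cancel:
  "reduced w \<Longrightarrow> letter_mult p (letter_mult (\<not> fst p, snd p) w) = w"
  by (cases w rule: reduced.cases) (auto simp: prod_eq_iff)

lemma foldr_letter_mult:
  "reduced v \<Longrightarrow> foldr letter_mult (letter_mult p u) v = letter_mult p (foldr letter_mult u v)"
  by (cases u) (auto simp: letter_mult_cancel reduced_foldr)

lemma foldr_assoc:
  "reduced w \<Longrightarrow>
    foldr letter_mult (foldr letter_mult u v) w = foldr letter_mult u (foldr letter_mult v w)"
  by (induction u) (auto simp: foldr_letter_mult)

lemma foldr_Nil: "reduced w \<Longrightarrow> foldr letter_mult w [] = w"
proof (induction w)
  case (Cons p w)
  then show ?case
    by (cases w) (auto dest: reduced_tl)
qed simp

lemma foldr_inverse:
  "reduced v \<Longrightarrow>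
    foldr letter_mult (rev (map (\<lambda>p. (\<not> fst p, snd p)) u)) (foldr letter_mult u v) = v"
proof (induction u)
  case (Cons p u)
  then show ?case
    using letter_mult_cancel[OF reduced_foldr[OF Cons.prems], of "(\<not> fst p, snd p)"] by simp
qed simp

theorem group_free_group: "group (free_group S)"
proof (rule groupI)
  fix x assume x: "x \<in> carrier (free_group S)"
  define y where "y = foldr letter_mult (rev (map (\<lambda>p. (\<not> fst p, snd p)) x)) []"
  have "set y \<subseteq> (\<lambda>p. (\<not> fst p, snd p)) ` set x"
    using set_foldr[of "rev (map (\<lambda>p. (\<not> fst p, snd p)) x)" "[]"] by (simp add: y_def)
  then have "y \<in> carrier (free_group S)"
    using x by (fastforce simp: free_group_def y_def intro: reduced_foldr)
  moreover have "y \<otimes>\<^bsub>free_group S\<^esub> x = \<one>\<^bsub>free_group S\<^esub>"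
    using x foldr_inverse[of "[]" x] foldr_Nil[of x]
    by (simp add: free_group_def y_def foldr_assoc)
  ultimately show "\<exists>y\<in>carrier (free_group S). y \<otimes>\<^bsub>free_group S\<^esub> x = \<one>\<^bsub>free_group S\<^esub>"
    by blast
next
  fix x y assume "x \<in> carrier (free_group S)" "y \<in> carrier (free_group S)"
  then show "x \<otimes>\<^bsub>free_group S\<^esub> y \<in> carrier (free_group S)"
    using set_foldr[of x y] by (fastforce simp: free_group_def intro: reduced_foldr)
qed (auto simp: free_group_def foldr_assoc)

lemma gen_closed: "s \<in> S \<Longrightarrow> gen s \<in> carrier (free_group S)"
  by (simp add: free_group_def gen_def)

lemma word_value_closed:
  assumes "group H" "\<phi> \<in> S \<rightarrow> carrier H" "snd ` set w \<subseteq> S"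
  shows "word_value H \<phi> w \<in> carrier H"
proof -
  interpret group H by fact
  show ?thesis
    using assms(2,3) by (induction w) (auto simp: Pi_iff)
qed

lemma word_value_letter_mult:
  assumes "group H" "\<phi> \<in> S \<rightarrow> carrier H" "snd ` set (p # w) \<subseteq> S"
  shows "word_value H \<phi> (letter_mult p w) = word_value H \<phi> (p # w)"
proof -
  interpret group H by fact
  show ?thesis
  proof (cases w)
    case (Cons q v)
    have "word_value H \<phi> v \<in> carrier H" "\<phi> (snd p) \<in> carrier H"
      using assms word_value_closed[of H \<phi> S v] Cons by (auto simp: Pi_iff)
    then show ?thesis
      using Cons by (auto simp flip: m_assoc)
  qed simp
qed

theorem word_value_hom:
  assumes "group H" "\<phi> \<in> S \<rightarrow> carrier H"
  shows "word_value H \<phi> \<in> hom (free_group S) H"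
proof -
  interpret group H by fact
  have "word_value H \<phi> (foldr letter_mult u v) = word_value H \<phi> u \<otimes>\<^bsub>H\<^esub> word_value H \<phi> v"
    if "snd ` set u \<subseteq> S" "snd ` set v \<subseteq> S" for u v
    using that
  proof (induction u)
    case Nil
    then show ?case
      using assms word_value_closed by fastforce
  next
    case (Cons p u)
    have "snd ` set (p # foldr letter_mult u v) \<subseteq> S"
      using Cons.prems set_foldr[of u v] by fastforce
    then have "word_value H \<phi> (foldr letter_mult (p # u) v) =
        word_value H \<phi> (p # foldr letter_mult u v)"
      using word_value_letter_mult[OF assms] by simp
    moreover have "word_value H \<phi> u \<in> carrier H" "word_value H \<phi> v \<in> carrier H"
        "\<phi> (snd p) \<in> carrier H"
      using assms Cons.prems word_value_closed[OF assms] by (auto simp: Pi_iff)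
    ultimately show ?case
      using Cons by (auto simp: m_assoc)
  qed
  then show ?thesis
    using word_value_closed[OF assms] by (auto simp: hom_def free_group_def)
qed

lemma word_value_gen:
  assumes "group H" "\<phi> s \<in> carrier H"
  shows "word_value H \<phi> (gen s) = \<phi> s"
  using assms by (simp add: gen_def group.is_monoid)

definition normal_closure :: "('g, 'b) monoid_scheme \<Rightarrow> 'g set \<Rightarrow> 'g set" where
  "normal_closure H W = \<Inter>{N. N \<lhd> H \<and> W \<subseteq> N}"


section \<open>Equations with coefficients\<close>

text \<open>The free product of the free groups of rank \<open>l\<close> and \<open>m\<close> is the free group on the disjoint union
  of their bases: \<open>Inl i\<close> for \<open>i < l\<close> are the coefficient letters, \<open>Inr j\<close> for \<open>j < m\<close> are the
  variables. Indices start at 0.\<close>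

definition free_product :: "nat \<Rightarrow> nat \<Rightarrow> (nat + nat) word monoid" where
  "free_product l m = free_group ({..<l} <+> {..<m})"

definition presented_group :: "nat \<Rightarrow> nat \<Rightarrow> (nat + nat) word set \<Rightarrow> (nat + nat) word set monoid"
  where "presented_group l m W = free_product l m Mod normal_closure (free_product l m) W"

definition presented_gen :: "nat \<Rightarrow> nat \<Rightarrow> (nat + nat) word set \<Rightarrow> nat + nat \<Rightarrow> (nat + nat) word set"
  where "presented_gen l m W s =
    normal_closure (free_product l m) W #>\<^bsub>free_product l m\<^esub> gen s"

definition solution ::
  "('g, 'b) monoid_scheme \<Rightarrow> nat \<Rightarrow> (nat + nat) word set \<Rightarrow> (nat \<Rightarrow> 'g) \<Rightarrow> (nat \<Rightarrow> 'g) \<Rightarrow> bool"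
  where "solution H m W a h \<longleftrightarrow>
    (\<forall>j<m. h j \<in> carrier H) \<and> (\<forall>w\<in>W. word_value H (case_sum a h) w = \<one>\<^bsub>H\<^esub>)"

definition delta_solution ::
  "('g, 'b) monoid_scheme \<Rightarrow> ('g \<Rightarrow> 'g \<Rightarrow> real) \<Rightarrow> real \<Rightarrow> nat \<Rightarrow> (nat + nat) word set \<Rightarrow>
    (nat \<Rightarrow> 'g) \<Rightarrow> (nat \<Rightarrow> 'g) \<Rightarrow> bool"
  where "delta_solution H d \<delta> m W a h \<longleftrightarrow>
    (\<forall>j<m. h j \<in> carrier H) \<and> (\<forall>w\<in>W. d (word_value H (case_sum a h) w) \<one>\<^bsub>H\<^esub> < \<delta>)"


section \<open>Approximating families and constraint stability\<close>

text \<open>The infimum is taken in the extended reals, so that it is \<open>\<infinity>\<close> for the empty family.\<close>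

definition approximating_family ::
  "'i set \<Rightarrow> ('i \<Rightarrow> ('g, 'b) monoid_scheme) \<Rightarrow> ('i \<Rightarrow> 'g \<Rightarrow> 'g \<Rightarrow> real) \<Rightarrow> ('i \<Rightarrow> real) \<Rightarrow> bool"
  where "approximating_family I G d eps \<longleftrightarrow>
    (\<forall>\<alpha>\<in>I. group (G \<alpha>) \<and> Metric_space (carrier (G \<alpha>)) (d \<alpha>) \<and>
      (\<forall>x\<in>carrier (G \<alpha>). \<forall>y\<in>carrier (G \<alpha>). \<forall>z\<in>carrier (G \<alpha>).
        d \<alpha> (z \<otimes>\<^bsub>G \<alpha>\<^esub> x) (z \<otimes>\<^bsub>G \<alpha>\<^esub> y) = d \<alpha> x y \<and>
        d \<alpha> (x \<otimes>\<^bsub>G \<alpha>\<^esub> z) (y \<otimes>\<^bsub>G \<alpha>\<^esub> z) = d \<alpha> x y) \<and>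
      0 < eps \<alpha>) \<and>
    0 < (INF \<alpha>\<in>I. ereal (eps \<alpha>))"

definition constraint_stable ::
  "'i set \<Rightarrow> ('i \<Rightarrow> ('g, 'b) monoid_scheme) \<Rightarrow> ('i \<Rightarrow> 'g \<Rightarrow> 'g \<Rightarrow> real) \<Rightarrow>
    nat \<Rightarrow> (nat + nat) word set \<Rightarrow> ('i \<Rightarrow> nat \<Rightarrow> 'g) \<Rightarrow> bool"
  where "constraint_stable I G d m W a \<longleftrightarrow>
    (\<forall>\<epsilon>>0. \<exists>\<delta>>0. \<forall>\<alpha>\<in>I. \<forall>g. delta_solution (G \<alpha>) (d \<alpha>) \<delta> m W (a \<alpha>) g \<longrightarrow>
      (\<exists>g'. solution (G \<alpha>) m W (a \<alpha>) g' \<and> (\<forall>j<m. d \<alpha> (g j) (g' j) < \<epsilon>)))"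


section \<open>Metric ultraproducts and lifts\<close>

text \<open>An ultrafilter over the natural numbers is represented by the filter \<open>\<omega>\<close> for which
  \<open>eventually P \<omega>\<close> means that the set of all \<open>k\<close> with \<open>P k\<close> belongs to the ultrafilter.\<close>

definition nonprincipal_ultrafilter :: "nat filter \<Rightarrow> bool" where
  "nonprincipal_ultrafilter \<omega> \<longleftrightarrow>
    \<omega> \<noteq> bot \<and>
    (\<forall>P. eventually P \<omega> \<or> eventually (\<lambda>k. \<not> P k) \<omega>) \<and>
    (\<forall>n. \<not> eventually (\<lambda>k. k = n) \<omega>)"

definition null_sequences ::
  "nat filter \<Rightarrow> (nat \<Rightarrow> ('g, 'b) monoid_scheme) \<Rightarrow> (nat \<Rightarrow> 'g \<Rightarrow> 'g \<Rightarrow> real) \<Rightarrow> (nat \<Rightarrow> 'g) set"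
  where "null_sequences \<omega> H d =
    {g \<in> carrier (product_group UNIV H). ((\<lambda>k. d k (g k) \<one>\<^bsub>H k\<^esub>) \<longlongrightarrow> 0) \<omega>}"

definition metric_ultraproduct ::
  "nat filter \<Rightarrow> (nat \<Rightarrow> ('g, 'b) monoid_scheme) \<Rightarrow> (nat \<Rightarrow> 'g \<Rightarrow> 'g \<Rightarrow> real) \<Rightarrow>
    (nat \<Rightarrow> 'g) set monoid"
  where "metric_ultraproduct \<omega> H d = product_group UNIV H Mod null_sequences \<omega> H d"

definition ultraclass ::
  "nat filter \<Rightarrow> (nat \<Rightarrow> ('g, 'b) monoid_scheme) \<Rightarrow> (nat \<Rightarrow> 'g \<Rightarrow> 'g \<Rightarrow> real) \<Rightarrow> (nat \<Rightarrow> 'g) \<Rightarrow>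
    (nat \<Rightarrow> 'g) set"
  where "ultraclass \<omega> H d g = null_sequences \<omega> H d #>\<^bsub>product_group UNIV H\<^esub> g"

definition constraint_hom ::
  "('i \<Rightarrow> ('g, 'b) monoid_scheme) \<Rightarrow> ('i \<Rightarrow> 'g \<Rightarrow> 'g \<Rightarrow> real) \<Rightarrow>
    nat \<Rightarrow> nat \<Rightarrow> (nat + nat) word set \<Rightarrow> ('i \<Rightarrow> nat \<Rightarrow> 'g) \<Rightarrow>
    nat filter \<Rightarrow> (nat \<Rightarrow> 'i) \<Rightarrow> ((nat + nat) word set \<Rightarrow> (nat \<Rightarrow> 'g) set) \<Rightarrow> bool"
  where "constraint_hom G d l m W a \<omega> f \<theta> \<longleftrightarrow>
    \<theta> \<in> hom (presented_group l m W) (metric_ultraproduct \<omega> (\<lambda>k. G (f k)) (\<lambda>k. d (f k))) \<and>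
    (\<forall>i<l. \<theta> (presented_gen l m W (Inl i)) =
      ultraclass \<omega> (\<lambda>k. G (f k)) (\<lambda>k. d (f k)) (\<lambda>k. a (f k) i))"

definition constraint_liftable ::
  "('i \<Rightarrow> ('g, 'b) monoid_scheme) \<Rightarrow> ('i \<Rightarrow> 'g \<Rightarrow> 'g \<Rightarrow> real) \<Rightarrow>
    nat \<Rightarrow> nat \<Rightarrow> (nat + nat) word set \<Rightarrow> ('i \<Rightarrow> nat \<Rightarrow> 'g) \<Rightarrow>
    nat filter \<Rightarrow> (nat \<Rightarrow> 'i) \<Rightarrow> ((nat + nat) word set \<Rightarrow> (nat \<Rightarrow> 'g) set) \<Rightarrow> bool"
  where "constraint_liftable G d l m W a \<omega> f \<theta> \<longleftrightarrow>
    (\<exists>g. (\<forall>k. solution (G (f k)) m W (a (f k)) (g k)) \<and>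
      (\<forall>j<m. \<theta> (presented_gen l m W (Inr j)) =
        ultraclass \<omega> (\<lambda>k. G (f k)) (\<lambda>k. d (f k)) (\<lambda>k. g k j)))"

text \<open>A constraint lift needs a solution in every \<open>G (f k)\<close>, whereas a homomorphism into the
  ultraproduct only depends on \<open>\<omega>\<close>-almost all \<open>k\<close>. When the system is solvable in some members of the
  family but not in all of them, a stable system has homomorphisms without a constraint lift: take the
  system consisting of the equation \<open>a\<^sub>1 = 1\<close>, a family with two members in which \<open>a\<^sub>1\<close> is nontrivial,
  respectively trivial, and a function \<open>f\<close> that takes the first member as value at \<open>k = 0\<close> only. The next
  definition asks for the equations at \<open>\<omega>\<close>-almost all \<open>k\<close>.\<close>

definition constraint_liftable_ae ::
  "('i \<Rightarrow> ('g, 'b) monoid_scheme) \<Rightarrow> ('i \<Rightarrow> 'g \<Rightarrow> 'g \<Rightarrow> real) \<Rightarrow>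
    nat \<Rightarrow> nat \<Rightarrow> (nat + nat) word set \<Rightarrow> ('i \<Rightarrow> nat \<Rightarrow> 'g) \<Rightarrow>
    nat filter \<Rightarrow> (nat \<Rightarrow> 'i) \<Rightarrow> ((nat + nat) word set \<Rightarrow> (nat \<Rightarrow> 'g) set) \<Rightarrow> bool"
  where "constraint_liftable_ae G d l m W a \<omega> f \<theta> \<longleftrightarrow>
    (\<exists>g. (\<forall>k. \<forall>j<m. g k j \<in> carrier (G (f k))) \<and>
      (\<forall>\<^sub>F k in \<omega>. solution (G (f k)) m W (a (f k)) (g k)) \<and>
      (\<forall>j<m. \<theta> (presented_gen l m W (Inr j)) =
        ultraclass \<omega> (\<lambda>k. G (f k)) (\<lambda>k. d (f k)) (\<lambda>k. g k j)))"

end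

theory Submission
  imports Defs
begin

text \<open>
  Homomorphisms from the presented group to a metric ultraproduct that have the prescribed values on
  the coefficients are, up to null sequences, sequences of tuples which become \<open>\<delta>\<close>-solutions for every
  \<open>\<delta> > 0\<close> along the ultrafilter: a word is trivial in the ultraproduct iff its values in the factors
  tend to the identity (\<open>word_value_ultraproduct_eq_one_iff\<close>), and two sequences represent the same
  element iff their distance tends to \<open>0\<close> (\<open>ultraclass_eq_iff\<close>). A lift is thus a sequence of exact
  solutions at vanishing distance from the given approximate ones, and the theorem compares a
  statement uniform in \<open>\<alpha>\<close> with its sequential version.

  If the system is stable and \<open>(g\<^sub>k)\<close> represents \<open>\<theta>\<close>, then, for each \<open>\<epsilon> > 0\<close>, almost every
  \<open>g\<^sub>k\<close> is a \<open>\<delta>\<close>-solution for the matching \<open>\<delta>\<close>, since there are only finitely many equations; so it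
  has an exact solution within \<open>\<epsilon>\<close>. The solution near \<open>g\<^sub>k\<close> must be chosen independently of \<open>\<epsilon>\<close>,
  and a choice that minimizes the distance up to \<open>1 / Suc k\<close> does this
  (\<open>near_minimizers_tendsto\<close>).

  If the system is not stable, some \<open>\<epsilon>\<close> admits, for every \<open>k\<close>, an index \<open>f k\<close> and a
  \<open>1 / Suc k\<close>-solution in \<open>G (f k)\<close> without an exact solution within \<open>\<epsilon>\<close>. Along any nonprincipal
  ultrafilter these tuples define a homomorphism, and a lift would contradict the choice of the tuples
  already at a single \<open>k\<close>.

  Stability provides the exact solutions only for almost all \<open>k\<close>. At the remaining \<open>k\<close> any solution
  may be used, which exists if solvability in one member of the family implies solvability in all of
  them: a lift at almost all \<open>k\<close> exhibits a member where the system is solvable.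
\<close>

section \<open>Nonprincipal ultrafilters\<close>

lemma nonprincipal_ultrafilter_le_sequentially:
  assumes "nonprincipal_ultrafilter \<omega>"
  shows "\<omega> \<le> sequentially"
proof (rule filter_leI)
  fix P :: "nat \<Rightarrow> bool"
  assume "eventually P sequentially"
  then obtain n where n: "\<And>k. n \<le> k \<Longrightarrow> P k"
    by (auto simp: eventually_sequentially)
  have "\<forall>\<^sub>F k in \<omega>. k \<noteq> i" for i
    using assms unfolding nonprincipal_ultrafilter_def by blast
  then have "\<forall>\<^sub>F k in \<omega>. \<forall>i\<in>{..<n}. k \<noteq> i"
    by (intro eventually_ball_finite) auto
  then show "eventually P \<omega>"
    by (rule eventually_mono) (use n not_less in blast)
qed

text \<open>By Zorn's lemma there is a minimal proper filter below \<^term>\<open>sequentially\<close>. Minimality makes it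
  an ultrafilter: if the complement of a set is not in the filter, adjoining the set yields a proper
  filter, hence the same one.\<close>

lemma nonprincipal_ultrafilter_exists: "\<exists>\<omega>. nonprincipal_ultrafilter \<omega>"
proof -
  define A where "A = {F :: nat filter. F \<noteq> bot \<and> F \<le> sequentially}"
  have "\<exists>\<omega>\<in>A. \<forall>F\<in>A. F \<le> \<omega> \<longrightarrow> F = \<omega>"
  proof (rule predicate_Zorn)
    show "partial_order_on A (relation_of (\<lambda>F G. G \<le> F) A)"
      by (rule partial_order_on_relation_ofI) auto
  next
    fix C assume C: "C \<in> Chains (relation_of (\<lambda>F G. G \<le> F) A)"
    then have sub: "C \<subseteq> A" and total: "\<And>F G. F \<in> C \<Longrightarrow> G \<in> C \<Longrightarrow> F \<le> G \<or> G \<le> F"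
      by (auto simp: Chains_def relation_of_def)
    show "\<exists>U\<in>A. \<forall>F\<in>C. U \<le> F"
    proof (cases "C = {}")
      case True
      then show ?thesis
        by (auto simp: A_def intro!: exI[of _ sequentially])
    next
      case False
      have "eventually P (Inf C) \<longleftrightarrow> (\<exists>F\<in>C. eventually P F)" for P
        proof (rule eventually_Inf_base[OF False])
          fix F G assume "F \<in> C" "G \<in> C"
          then show "\<exists>x\<in>C. x \<le> inf F G"
            using total[of F G] by (auto simp: inf_absorb1 inf_absorb2)
        qed
      then have "Inf C \<noteq> bot"
        using sub by (auto simp: trivial_limit_def A_def)
      moreover have "Inf C \<le> sequentially"
        using False sub by (auto simp: A_def intro: Inf_lower2)
      ultimately show ?thesis
        by (auto simp: A_def intro!: bexI[of _ "Inf C"] Inf_lower)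
    qed
  qed
  then obtain \<omega> where \<omega>: "\<omega> \<noteq> bot" "\<omega> \<le> sequentially"
    and minimal: "\<And>F. F \<noteq> bot \<Longrightarrow> F \<le> \<omega> \<Longrightarrow> F = \<omega>"
    unfolding A_def by (auto dest: order_trans)
  have "eventually P \<omega> \<or> eventually (\<lambda>k. \<not> P k) \<omega>" for P
  proof (cases "inf \<omega> (principal {k. P k}) = bot")
    case True
    then show ?thesis
      by (simp add: trivial_limit_def eventually_inf_principal)
  next
    case False
    then have "inf \<omega> (principal {k. P k}) = \<omega>"
      by (rule minimal) simp
    moreover have "eventually P (inf \<omega> (principal {k. P k}))"
      by (simp add: eventually_inf_principal)
    ultimately show ?thesis
      by simp
  qed
  moreover have "\<not> eventually (\<lambda>k. k = n) \<omega>" for n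
  proof
    assume "eventually (\<lambda>k. k = n) \<omega>"
    moreover have "eventually (\<lambda>k. n < k) \<omega>"
      using \<omega>(2) eventually_gt_at_top by (rule filter_leD)
    ultimately have "eventually (\<lambda>_. False) \<omega>"
      by eventually_elim simp
    then show False
      using \<omega>(1) by (simp add: trivial_limit_def)
  qed
  ultimately show ?thesis
    using \<omega>(1) unfolding nonprincipal_ultrafilter_def by blast
qed

text \<open>Near-minimizers of \<open>r k\<close> work for all tolerances simultaneously: if some \<open>y\<close> with \<open>Q k y\<close> has
  \<open>r k y < \<epsilon>\<close>, then \<open>r k (x k) < \<epsilon> + 1 / Suc k\<close>, and the second summand vanishes along \<open>\<omega>\<close>.\<close>

lemma near_minimizers_tendsto:
  fixes r :: "nat \<Rightarrow> 'a \<Rightarrow> real"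
  assumes "\<omega> \<le> sequentially"
    and nonneg: "\<And>k y. 0 \<le> r k y"
    and ex: "\<And>\<epsilon>. 0 < \<epsilon> \<Longrightarrow> \<forall>\<^sub>F k in \<omega>. \<exists>y. Q k y \<and> r k y < \<epsilon>"
  shows "\<exists>x. (\<forall>\<^sub>F k in \<omega>. Q k (x k)) \<and> ((\<lambda>k. r k (x k)) \<longlongrightarrow> 0) \<omega>"
proof -
  have "\<exists>x. Q k x \<and> (\<forall>y. Q k y \<longrightarrow> r k x < r k y + 1 / Suc k)" if "\<exists>y. Q k y" for k
  proof -
    have "r k ` Collect (Q k) \<noteq> {}"
      using that by auto
    then obtain x where x: "Q k x" "r k x < Inf (r k ` Collect (Q k)) + 1 / Suc k"
      using cInf_lessD[of "r k ` Collect (Q k)" "Inf (r k ` Collect (Q k)) + 1 / Suc k"] by auto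
    have "Inf (r k ` Collect (Q k)) \<le> r k y" if "Q k y" for y
      using that nonneg by (intro cInf_lower bdd_belowI2[of _ 0]) auto
    then show ?thesis
      using x by force
  qed
  then obtain x where
    x: "\<And>k. \<exists>y. Q k y \<Longrightarrow> Q k (x k) \<and> (\<forall>y. Q k y \<longrightarrow> r k (x k) < r k y + 1 / Suc k)"
    by metis
  have "\<forall>\<^sub>F k in \<omega>. Q k (x k)"
    using ex[of 1] by (rule eventually_mono) (use x in auto)
  moreover have "((\<lambda>k. r k (x k)) \<longlongrightarrow> 0) \<omega>"
  proof (rule tendstoI)
    fix \<epsilon> :: real assume "0 < \<epsilon>"
    have "\<forall>\<^sub>F k in sequentially. 1 / Suc k < \<epsilon> / 2"
      using order_tendstoD(2)[OF LIMSEQ_Suc[OF lim_1_over_n], of "\<epsilon> / 2"] \<open>0 < \<epsilon>\<close> by simp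
    then have "\<forall>\<^sub>F k in \<omega>. 1 / Suc k < \<epsilon> / 2"
      using assms(1) by (rule filter_leD[rotated])
    moreover have "\<forall>\<^sub>F k in \<omega>. \<exists>y. Q k y \<and> r k y < \<epsilon> / 2"
      using \<open>0 < \<epsilon>\<close> by (intro ex) simp
    ultimately show "\<forall>\<^sub>F k in \<omega>. dist (r k (x k)) 0 < \<epsilon>"
    proof eventually_elim
      case (elim k)
      then obtain y where "Q k y" "r k y < \<epsilon> / 2"
        by blast
      then have "r k (x k) < r k y + 1 / Suc k"
        using x by blast
      then show ?case
        using elim \<open>r k y < \<epsilon> / 2\<close> nonneg[of k "x k"] by simp
    qed
  qed
  ultimately show ?thesis
    by blast
qed


section \<open>Homomorphisms on finitely presented groups\<close>

lemma word_value_cong: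
  "(\<And>s. s \<in> snd ` set w \<Longrightarrow> \<phi> s = \<psi> s) \<Longrightarrow> word_value H \<phi> w = word_value H \<psi> w"
  by (induction w) auto

lemma hom_word_value:
  assumes "group H" "group K" "h \<in> hom H K" "\<phi> \<in> S \<rightarrow> carrier H" "snd ` set w \<subseteq> S"
  shows "h (word_value H \<phi> w) = word_value K (\<lambda>s. h (\<phi> s)) w"
proof -
  interpret group_hom H K h
    using assms(1-3) by (simp add: group_hom_def group_hom_axioms_def)
  show ?thesis
    using assms(5)
  proof (induction w)
    case (Cons p w)
    then have "\<phi> (snd p) \<in> carrier H" "word_value H \<phi> w \<in> carrier H"
      using assms(1,4) word_value_closed[of H \<phi> S w] by auto
    then show ?case
      using Cons by simp
  qed simp
qed

lemma word_value_free_group_gen: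
  assumes "w \<in> carrier (free_group S)"
  shows "word_value (free_group S) gen w = w"
  using assms
proof (induction w)
  case Nil
  then show ?case
    by (simp add: free_group_def)
next
  case (Cons p w)
  interpret group "free_group S"
    by (rule group_free_group)
  have p: "snd p \<in> S" and w: "w \<in> carrier (free_group S)" and red: "reduced (p # w)"
    using Cons.prems by (auto simp: free_group_def dest: reduced_tl)
  have "inv\<^bsub>free_group S\<^esub> gen (snd p) = [(False, snd p)]"
    using p by (intro inv_equality) (auto simp: free_group_def gen_def)
  then have "(if fst p then gen (snd p) else inv\<^bsub>free_group S\<^esub> gen (snd p)) = [p]"
    by (cases p) (auto simp: gen_def)
  moreover have "[p] \<otimes>\<^bsub>free_group S\<^esub> w = p # w"
    using red by (cases w) (auto simp: free_group_def)
  ultimately show ?case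
    using Cons.IH[OF w] by simp
qed

lemma hom_free_group_eq_word_value:
  assumes "group K" "h \<in> hom (free_group S) K" "w \<in> carrier (free_group S)"
  shows "h w = word_value K (\<lambda>s. h (gen s)) w"
proof -
  have "h (word_value (free_group S) gen w) = word_value K (\<lambda>s. h (gen s)) w"
    using assms(3) by (intro hom_word_value[OF group_free_group assms(1,2), of gen S])
      (auto intro: gen_closed, auto simp: free_group_def)
  then show ?thesis
    using assms(3) by (simp add: word_value_free_group_gen)
qed

lemma normal_closure_normal:
  assumes "group H" "W \<subseteq> carrier H"
  shows "normal_closure H W \<lhd> H"
proof -
  interpret group H by fact
  have "carrier H \<lhd> H"
    by (simp add: normal_inv_iff subgroup_self)
  then have ne: "{N. N \<lhd> H \<and> W \<subseteq> N} \<noteq> {}"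
    using assms(2) by blast
  have "subgroup (normal_closure H W) H"
    unfolding normal_closure_def
    by (rule subgroups_Inter[OF _ ne]) (simp add: normal_imp_subgroup)
  then show ?thesis
    by (auto simp: normal_inv_iff normal_closure_def)
qed

lemma subset_normal_closure: "W \<subseteq> normal_closure H W"
  unfolding normal_closure_def by blast

lemma normal_closure_minimal: "N \<lhd> H \<Longrightarrow> W \<subseteq> N \<Longrightarrow> normal_closure H W \<subseteq> N"
  unfolding normal_closure_def by blast

context
  fixes l m :: nat and W :: "(nat + nat) word set"
  assumes W: "W \<subseteq> carrier (free_product l m)"
begin

lemma group_free_product: "group (free_product l m)"
  by (simp add: free_product_def group_free_group)

lemma normal_closure_relators: "normal_closure (free_product l m) W \<lhd> free_product l m"
  using group_free_product W by (rule normal_closure_normal)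

lemma group_presented_group: "group (presented_group l m W)"
  unfolding presented_group_def
  using normal_closure_relators by (rule normal.factorgroup_is_group)

lemma presented_gen_closed:
  "s \<in> {..<l} <+> {..<m} \<Longrightarrow> presented_gen l m W s \<in> carrier (presented_group l m W)"
  using gen_closed[of s "{..<l} <+> {..<m}"]
  by (auto simp: presented_group_def presented_gen_def carrier_FactGroup free_product_def)

lemma letters_relator: "w \<in> W \<Longrightarrow> snd ` set w \<subseteq> {..<l} <+> {..<m}"
  using W by (auto simp: free_product_def free_group_def)

text \<open>The universal property of a presentation: the kernel of the evaluation homomorphism is a normal
  subgroup that contains the relators, hence contains their normal closure.\<close>

lemma presented_group_hom_exists:
  assumes K: "group K" and \<phi>: "\<phi> \<in> {..<l} <+> {..<m} \<rightarrow> carrier K"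
    and rel: "\<And>w. w \<in> W \<Longrightarrow> word_value K \<phi> w = \<one>\<^bsub>K\<^esub>"
  shows "\<exists>\<theta>\<in>hom (presented_group l m W) K. \<forall>s\<in>{..<l} <+> {..<m}. \<theta> (presented_gen l m W s) = \<phi> s"
proof -
  have "word_value K \<phi> \<in> hom (free_product l m) K"
    unfolding free_product_def using K \<phi> by (rule word_value_hom)
  then interpret group_hom "free_product l m" K "word_value K \<phi>"
    using K group_free_product by (simp add: group_hom_def group_hom_axioms_def)
  have "W \<subseteq> kernel (free_product l m) K (word_value K \<phi>)"
    using W rel by (auto simp: kernel_def)
  then have "normal_closure (free_product l m) W \<subseteq> kernel (free_product l m) K (word_value K \<phi>)"
    by (intro normal_closure_minimal normal_kernel)
  then obtain \<theta> where \<theta>: "\<theta> \<in> hom (presented_group l m W) K"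
    and val: "\<And>w. w \<in> carrier (free_product l m) \<Longrightarrow>
      \<theta> (normal_closure (free_product l m) W #>\<^bsub>free_product l m\<^esub> w) = word_value K \<phi> w"
    using FactGroup_universal_kernel[OF normal_closure_relators] unfolding presented_group_def by blast
  have "\<theta> (presented_gen l m W s) = \<phi> s" if "s \<in> {..<l} <+> {..<m}" for s
    using that \<phi> K val[of "gen s"] gen_closed[of s "{..<l} <+> {..<m}"] word_value_gen[of K \<phi> s]
    by (auto simp: presented_gen_def free_product_def)
  then show ?thesis
    using \<theta> by blast
qed

text \<open>Evaluating a word at the images of the generators is the composition of \<open>\<theta>\<close> with the quotient map,
  because a homomorphism on a free group is determined by the generators; the quotient map kills the
  relators.\<close>

lemma presented_group_relation:
  assumes K: "group K" and \<theta>: "\<theta> \<in> hom (presented_group l m W) K" and w: "w \<in> W"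
  shows "word_value K (\<lambda>s. \<theta> (presented_gen l m W s)) w = \<one>\<^bsub>K\<^esub>"
proof -
  let ?F = "free_product l m"
  let ?N = "normal_closure ?F W"
  have "(\<lambda>w. ?N #>\<^bsub>?F\<^esub> w) \<in> hom ?F (presented_group l m W)"
    unfolding presented_group_def using normal_closure_relators by (rule normal.r_coset_hom_Mod)
  then have "(\<lambda>w. \<theta> (?N #>\<^bsub>?F\<^esub> w)) \<in> hom ?F K"
    using Group.hom_compose[of "\<lambda>w. ?N #>\<^bsub>?F\<^esub> w", OF _ \<theta>] by (simp add: comp_def)
  then have "word_value K (\<lambda>s. \<theta> (presented_gen l m W s)) w = \<theta> (?N #>\<^bsub>?F\<^esub> w)"
    unfolding presented_gen_def using subsetD[OF W w] unfolding free_product_def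
    by (rule hom_free_group_eq_word_value[OF K, symmetric])
  also have "?N #>\<^bsub>?F\<^esub> w = ?N"
    using w W subset_normal_closure[of W ?F] normal_closure_relators
    by (intro group.coset_join2[OF group_free_product]) (auto dest: normal_imp_subgroup)
  also have "\<theta> ?N = \<one>\<^bsub>K\<^esub>"
    using hom_one[OF \<theta> group_presented_group K] by (simp add: presented_group_def)
  finally show ?thesis .
qed

end


section \<open>Metric ultraproducts\<close>

locale bi_invariant_metric_group = group G + Metric_space "carrier G" d
  for G (structure) and d +
  assumes left_invariant:
      "\<lbrakk>x \<in> carrier G; y \<in> carrier G; z \<in> carrier G\<rbrakk> \<Longrightarrow> d (z \<otimes> x) (z \<otimes> y) = d x y"
    and right_invariant:
      "\<lbrakk>x \<in> carrier G; y \<in> carrier G; z \<in> carrier G\<rbrakk> \<Longrightarrow> d (x \<otimes> z) (y \<otimes> z) = d x y"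
begin

lemma dist_quotient_one:
  assumes "x \<in> carrier G" "y \<in> carrier G"
  shows "d (x \<otimes> inv y) \<one> = d x y"
  using right_invariant[of x y "inv y"] assms by simp

lemma dist_inv_one:
  assumes "x \<in> carrier G"
  shows "d (inv x) \<one> = d x \<one>"
  using dist_quotient_one[of \<one> x] assms commute[of x \<one>] by simp

lemma dist_mult_one_le:
  assumes "x \<in> carrier G" "y \<in> carrier G"
  shows "d (x \<otimes> y) \<one> \<le> d x \<one> + d y \<one>"
  using triangle[of "x \<otimes> y" y \<one>] right_invariant[of x \<one> y] assms by simp

lemma dist_conjugate_one:
  assumes "x \<in> carrier G" "y \<in> carrier G"
  shows "d (x \<otimes> y \<otimes> inv x) \<one> = d y \<one>"
  using dist_quotient_one[of "x \<otimes> y" x] left_invariant[of y \<one> x] assms by simp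

end

locale metric_group_sequence =
  fixes H :: "nat \<Rightarrow> ('g, 'b) monoid_scheme" and d :: "nat \<Rightarrow> 'g \<Rightarrow> 'g \<Rightarrow> real"
    and \<omega> :: "nat filter"
  assumes metric_group: "\<And>k. bi_invariant_metric_group (H k) (d k)"
begin

lemma group_H: "group (H k)"
  using metric_group by (rule bi_invariant_metric_group.axioms)

lemma metric_H: "Metric_space (carrier (H k)) (d k)"
  using metric_group by (rule bi_invariant_metric_group.axioms)

lemma group_product: "group (product_group UNIV H)"
  by (simp add: group_H)

text \<open>Bi-invariance makes the distance to the identity a length function that is symmetric, subadditive
  and invariant under conjugation; these properties give closure under inverses, products and
  conjugation.\<close>

lemma null_sequences_normal: "null_sequences \<omega> H d \<lhd> product_group UNIV H"
proof -
  interpret P: group "product_group UNIV H"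
    by (rule group_product)
  note simps = null_sequences_def group_H
  show ?thesis
  proof (rule P.normal_invI)
    show "subgroup (null_sequences \<omega> H d) (product_group UNIV H)"
    proof (rule P.subgroupI)
      show "null_sequences \<omega> H d \<subseteq> carrier (product_group UNIV H)"
        by (auto simp: null_sequences_def)
      have "d k \<one>\<^bsub>H k\<^esub> \<one>\<^bsub>H k\<^esub> = 0" for k
        using metric_H[of k] group_H[of k] by (simp add: Metric_space.mdist_zero group.is_monoid)
      then have "\<one>\<^bsub>product_group UNIV H\<^esub> \<in> null_sequences \<omega> H d"
        by (simp add: simps group.is_monoid)
      then show "null_sequences \<omega> H d \<noteq> {}"
        by blast
    next
      fix g assume "g \<in> null_sequences \<omega> H d"
      then show "inv\<^bsub>product_group UNIV H\<^esub> g \<in> null_sequences \<omega> H d"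
        by (auto simp: simps PiE_iff bi_invariant_metric_group.dist_inv_one[OF metric_group])
    next
      fix g h assume gh: "g \<in> null_sequences \<omega> H d" "h \<in> null_sequences \<omega> H d"
      have le: "d k (g k \<otimes>\<^bsub>H k\<^esub> h k) \<one>\<^bsub>H k\<^esub> \<le> d k (g k) \<one>\<^bsub>H k\<^esub> + d k (h k) \<one>\<^bsub>H k\<^esub>" for k
        using gh by (intro bi_invariant_metric_group.dist_mult_one_le[OF metric_group])
          (auto simp: null_sequences_def)
      have sum0: "((\<lambda>k. d k (g k) \<one>\<^bsub>H k\<^esub> + d k (h k) \<one>\<^bsub>H k\<^esub>) \<longlongrightarrow> 0) \<omega>"
        using gh by (auto simp: null_sequences_def intro: tendsto_add_zero)
      have "((\<lambda>k. d k (g k \<otimes>\<^bsub>H k\<^esub> h k) \<one>\<^bsub>H k\<^esub>) \<longlongrightarrow> 0) \<omega>"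
        by (rule tendsto_sandwich[OF _ _ tendsto_const sum0])
          (auto simp: le Metric_space.nonneg[OF metric_H])
      then show "g \<otimes>\<^bsub>product_group UNIV H\<^esub> h \<in> null_sequences \<omega> H d"
        using gh by (auto simp: simps PiE_iff group.is_monoid monoid.m_closed)
    qed
  next
    fix x g assume "x \<in> carrier (product_group UNIV H)" "g \<in> null_sequences \<omega> H d"
    then show "x \<otimes>\<^bsub>product_group UNIV H\<^esub> g \<otimes>\<^bsub>product_group UNIV H\<^esub> inv\<^bsub>product_group UNIV H\<^esub> x
        \<in> null_sequences \<omega> H d"
      by (auto simp: simps PiE_iff group.is_monoid monoid.m_closed
          bi_invariant_metric_group.dist_conjugate_one[OF metric_group])
  qed
qed

lemma group_metric_ultraproduct: "group (metric_ultraproduct \<omega> H d)"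
  unfolding metric_ultraproduct_def
  using null_sequences_normal by (rule normal.factorgroup_is_group)

lemma ultraclass_hom:
  "ultraclass \<omega> H d \<in> hom (product_group UNIV H) (metric_ultraproduct \<omega> H d)"
  unfolding metric_ultraproduct_def ultraclass_def
  using null_sequences_normal by (rule normal.r_coset_hom_Mod)

lemma carrier_metric_ultraproduct:
  "carrier (metric_ultraproduct \<omega> H d) = ultraclass \<omega> H d ` carrier (product_group UNIV H)"
  by (simp add: metric_ultraproduct_def ultraclass_def carrier_FactGroup)

lemma ultraclass_eq_iff:
  assumes "\<And>k. g k \<in> carrier (H k)" "\<And>k. h k \<in> carrier (H k)"
  shows "ultraclass \<omega> H d g = ultraclass \<omega> H d h \<longleftrightarrow> ((\<lambda>k. d k (g k) (h k)) \<longlongrightarrow> 0) \<omega>"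
proof -
  interpret P: group "product_group UNIV H"
    by (rule group_product)
  have sub: "subgroup (null_sequences \<omega> H d) (product_group UNIV H)"
    using null_sequences_normal by (rule normal_imp_subgroup)
  have gh: "g \<in> carrier (product_group UNIV H)" "h \<in> carrier (product_group UNIV H)"
    using assms by auto
  have "ultraclass \<omega> H d g = ultraclass \<omega> H d h \<longleftrightarrow>
      g \<in> null_sequences \<omega> H d #>\<^bsub>product_group UNIV H\<^esub> h"
    unfolding ultraclass_def
    using P.repr_independence[OF _ gh(2) sub] P.rcos_self[OF gh(1) sub] by metis
  also have "\<dots> \<longleftrightarrow> g \<otimes>\<^bsub>product_group UNIV H\<^esub> inv\<^bsub>product_group UNIV H\<^esub> h \<in> null_sequences \<omega> H d"
    using subgroup.rcos_module[OF sub group_product gh(2) gh(1)] .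
  also have "\<dots> \<longleftrightarrow> ((\<lambda>k. d k (g k) (h k)) \<longlongrightarrow> 0) \<omega>"
    using assms by (auto simp: null_sequences_def group_H PiE_iff group.is_monoid monoid.m_closed
        bi_invariant_metric_group.dist_quotient_one[OF metric_group])
  finally show ?thesis .
qed

text \<open>Evaluation of words commutes with the projections of the product and with the quotient map onto
  the ultraproduct, so a word is trivial in the ultraproduct iff its values tend to the identity.\<close>

lemma word_value_ultraproduct_eq_one_iff:
  assumes \<phi>: "\<And>s k. s \<in> S \<Longrightarrow> \<phi> s k \<in> carrier (H k)" and w: "snd ` set w \<subseteq> S"
  shows "word_value (metric_ultraproduct \<omega> H d) (\<lambda>s. ultraclass \<omega> H d (\<phi> s)) w =
      \<one>\<^bsub>metric_ultraproduct \<omega> H d\<^esub> \<longleftrightarrow>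
    ((\<lambda>k. d k (word_value (H k) (\<lambda>s. \<phi> s k) w) \<one>\<^bsub>H k\<^esub>) \<longlongrightarrow> 0) \<omega>"
proof -
  let ?P = "product_group UNIV H"
  have \<phi>P: "\<phi> \<in> S \<rightarrow> carrier ?P"
    using \<phi> by (auto simp: Pi_iff)
  have coord: "word_value ?P \<phi> w k = word_value (H k) (\<lambda>s. \<phi> s k) w" for k
  proof (rule hom_word_value[OF group_product group_H _ \<phi>P w])
    show "(\<lambda>g. g k) \<in> hom ?P (H k)"
      by (auto simp: hom_def)
  qed
  have "ultraclass \<omega> H d (word_value ?P \<phi> w) =
      word_value (metric_ultraproduct \<omega> H d) (\<lambda>s. ultraclass \<omega> H d (\<phi> s)) w"
    by (rule hom_word_value[OF group_product group_metric_ultraproduct ultraclass_hom \<phi>P w])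
  moreover have "\<one>\<^bsub>metric_ultraproduct \<omega> H d\<^esub> = ultraclass \<omega> H d (\<lambda>k. \<one>\<^bsub>H k\<^esub>)"
    using hom_one[OF ultraclass_hom group_product group_metric_ultraproduct]
    by (simp add: restrict_UNIV)
  moreover have "word_value ?P \<phi> w k \<in> carrier (H k)" for k
    using word_value_closed[OF group_product \<phi>P w] by auto
  ultimately show ?thesis
    using ultraclass_eq_iff[of "word_value ?P \<phi> w" "\<lambda>k. \<one>\<^bsub>H k\<^esub>"]
    by (simp add: coord group_H group.is_monoid)
qed

end


section \<open>Stability and lifting\<close>

locale metric_group_family_with_system =
  fixes I :: "'i set"
    and G :: "'i \<Rightarrow> ('g, 'b) monoid_scheme"
    and d :: "'i \<Rightarrow> 'g \<Rightarrow> 'g \<Rightarrow> real"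
    and l m :: nat
    and a :: "'i \<Rightarrow> nat \<Rightarrow> 'g"
    and W :: "(nat + nat) word set"
  assumes metric_group_G: "\<And>\<alpha>. \<alpha> \<in> I \<Longrightarrow> bi_invariant_metric_group (G \<alpha>) (d \<alpha>)"
    and coefficient_closed: "\<And>\<alpha> i. \<alpha> \<in> I \<Longrightarrow> i < l \<Longrightarrow> a \<alpha> i \<in> carrier (G \<alpha>)"
    and finite_W: "finite W"
    and W_subset: "W \<subseteq> carrier (free_product l m)"
begin

lemma metric_group_sequence_reindex:
  assumes "f \<in> UNIV \<rightarrow> I"
  shows "metric_group_sequence (\<lambda>k. G (f k)) (\<lambda>k. d (f k))"
  using assms metric_group_G by (auto simp: metric_group_sequence_def)

lemma word_value_approximate_solution_iff:
  assumes f: "f \<in> UNIV \<rightarrow> I" and g: "\<And>k j. j < m \<Longrightarrow> g k j \<in> carrier (G (f k))" and w: "w \<in> W"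
    and \<phi>: "\<And>i. i < l \<Longrightarrow> \<phi> (Inl i) = ultraclass \<omega> (\<lambda>k. G (f k)) (\<lambda>k. d (f k)) (\<lambda>k. a (f k) i)"
      "\<And>j. j < m \<Longrightarrow> \<phi> (Inr j) = ultraclass \<omega> (\<lambda>k. G (f k)) (\<lambda>k. d (f k)) (\<lambda>k. g k j)"
  shows "word_value (metric_ultraproduct \<omega> (\<lambda>k. G (f k)) (\<lambda>k. d (f k))) \<phi> w =
      \<one>\<^bsub>metric_ultraproduct \<omega> (\<lambda>k. G (f k)) (\<lambda>k. d (f k))\<^esub> \<longleftrightarrow>
    ((\<lambda>k. d (f k) (word_value (G (f k)) (case_sum (a (f k)) (g k)) w) \<one>\<^bsub>G (f k)\<^esub>) \<longlongrightarrow> 0) \<omega>"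
proof -
  interpret metric_group_sequence "\<lambda>k. G (f k)" "\<lambda>k. d (f k)" \<omega>
    using f by (rule metric_group_sequence_reindex)
  have letters: "snd ` set w \<subseteq> {..<l} <+> {..<m}"
    using W_subset w by (rule letters_relator)
  have "\<phi> s = ultraclass \<omega> (\<lambda>k. G (f k)) (\<lambda>k. d (f k)) (\<lambda>k. case_sum (a (f k)) (g k) s)"
    if "s \<in> {..<l} <+> {..<m}" for s
    using that \<phi> by auto
  then have "word_value (metric_ultraproduct \<omega> (\<lambda>k. G (f k)) (\<lambda>k. d (f k))) \<phi> w =
      word_value (metric_ultraproduct \<omega> (\<lambda>k. G (f k)) (\<lambda>k. d (f k)))
        (\<lambda>s. ultraclass \<omega> (\<lambda>k. G (f k)) (\<lambda>k. d (f k)) (\<lambda>k. case_sum (a (f k)) (g k) s)) w"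
    using letters by (intro word_value_cong) blast
  moreover have "case_sum (a (f k)) (g k) s \<in> carrier (G (f k))" if "s \<in> {..<l} <+> {..<m}" for s k
    using that f g coefficient_closed by (auto simp: Pi_iff)
  ultimately show ?thesis
    using word_value_ultraproduct_eq_one_iff[OF _ letters, of "\<lambda>s k. case_sum (a (f k)) (g k) s"]
    by simp
qed

text \<open>The equations hold exactly in the ultraproduct, so the classes of the sequences satisfy the
  relations of the presented group and the universal property applies.\<close>

lemma approximate_solutions_give_hom:
  assumes f: "f \<in> UNIV \<rightarrow> I" and g: "\<And>k j. j < m \<Longrightarrow> g k j \<in> carrier (G (f k))"
    and lim: "\<And>w. w \<in> W \<Longrightarrow>
      ((\<lambda>k. d (f k) (word_value (G (f k)) (case_sum (a (f k)) (g k)) w) \<one>\<^bsub>G (f k)\<^esub>) \<longlongrightarrow> 0) \<omega>"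
  obtains \<theta> where "constraint_hom G d l m W a \<omega> f \<theta>"
    "\<And>j. j < m \<Longrightarrow> \<theta> (presented_gen l m W (Inr j)) =
      ultraclass \<omega> (\<lambda>k. G (f k)) (\<lambda>k. d (f k)) (\<lambda>k. g k j)"
proof -
  interpret metric_group_sequence "\<lambda>k. G (f k)" "\<lambda>k. d (f k)" \<omega>
    using f by (rule metric_group_sequence_reindex)
  let ?U = "metric_ultraproduct \<omega> (\<lambda>k. G (f k)) (\<lambda>k. d (f k))"
  define \<phi> where
    "\<phi> s = ultraclass \<omega> (\<lambda>k. G (f k)) (\<lambda>k. d (f k)) (\<lambda>k. case_sum (a (f k)) (g k) s)" for s
  have "(\<lambda>k. case_sum (a (f k)) (g k) s) \<in> carrier (product_group UNIV (\<lambda>k. G (f k)))"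
    if "s \<in> {..<l} <+> {..<m}" for s
    using that f g coefficient_closed by (auto simp: Pi_iff)
  then have "\<phi> \<in> {..<l} <+> {..<m} \<rightarrow> carrier ?U"
    unfolding \<phi>_def carrier_metric_ultraproduct by blast
  moreover have "word_value ?U \<phi> w = \<one>\<^bsub>?U\<^esub>" if "w \<in> W" for w
    using word_value_approximate_solution_iff[where g = g, OF f g that, of \<phi> \<omega>] lim[OF that]
    by (simp add: \<phi>_def)
  ultimately have "\<exists>\<theta>\<in>hom (presented_group l m W) ?U.
      \<forall>s\<in>{..<l} <+> {..<m}. \<theta> (presented_gen l m W s) = \<phi> s"
    by (rule presented_group_hom_exists[OF W_subset group_metric_ultraproduct])
  then obtain \<theta> where "\<theta> \<in> hom (presented_group l m W) ?U"
    "\<forall>s\<in>{..<l} <+> {..<m}. \<theta> (presented_gen l m W s) = \<phi> s" ..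
  then show thesis
    by (intro that[of \<theta>]) (simp_all add: constraint_hom_def \<phi>_def InlI InrI)
qed

lemma hom_gives_approximate_solutions:
  assumes f: "f \<in> UNIV \<rightarrow> I" and \<theta>: "constraint_hom G d l m W a \<omega> f \<theta>"
  obtains g where "\<And>k j. j < m \<Longrightarrow> g k j \<in> carrier (G (f k))"
    "\<And>j. j < m \<Longrightarrow> \<theta> (presented_gen l m W (Inr j)) =
      ultraclass \<omega> (\<lambda>k. G (f k)) (\<lambda>k. d (f k)) (\<lambda>k. g k j)"
    "\<And>w. w \<in> W \<Longrightarrow>
      ((\<lambda>k. d (f k) (word_value (G (f k)) (case_sum (a (f k)) (g k)) w) \<one>\<^bsub>G (f k)\<^esub>) \<longlongrightarrow> 0) \<omega>"
proof -
  interpret metric_group_sequence "\<lambda>k. G (f k)" "\<lambda>k. d (f k)" \<omega>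
    using f by (rule metric_group_sequence_reindex)
  let ?U = "metric_ultraproduct \<omega> (\<lambda>k. G (f k)) (\<lambda>k. d (f k))"
  have hom: "\<theta> \<in> hom (presented_group l m W) ?U"
    and \<theta>a: "\<And>i. i < l \<Longrightarrow> \<theta> (presented_gen l m W (Inl i)) =
      ultraclass \<omega> (\<lambda>k. G (f k)) (\<lambda>k. d (f k)) (\<lambda>k. a (f k) i)"
    using \<theta> by (auto simp: constraint_hom_def)
  have "\<exists>h\<in>carrier (product_group UNIV (\<lambda>k. G (f k))). \<theta> (presented_gen l m W (Inr j)) =
      ultraclass \<omega> (\<lambda>k. G (f k)) (\<lambda>k. d (f k)) h" if "j < m" for j
  proof -
    have "\<theta> (presented_gen l m W (Inr j)) \<in> carrier ?U"
      using that by (intro hom_in_carrier[OF hom] presented_gen_closed[OF W_subset]) auto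
    then show ?thesis
      unfolding carrier_metric_ultraproduct by blast
  qed
  then obtain h where h: "\<And>j. j < m \<Longrightarrow> h j \<in> carrier (product_group UNIV (\<lambda>k. G (f k)))"
    and \<theta>x: "\<And>j. j < m \<Longrightarrow> \<theta> (presented_gen l m W (Inr j)) =
      ultraclass \<omega> (\<lambda>k. G (f k)) (\<lambda>k. d (f k)) (h j)"
    by metis
  define g where "g k j = h j k" for k j
  have g: "g k j \<in> carrier (G (f k))" if "j < m" for k j
    using h[OF that] by (auto simp: g_def)
  have gx: "\<theta> (presented_gen l m W (Inr j)) =
      ultraclass \<omega> (\<lambda>k. G (f k)) (\<lambda>k. d (f k)) (\<lambda>k. g k j)" if "j < m" for j
    using \<theta>x[OF that] by (simp add: g_def)
  show thesis
  proof (rule that[of g])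
    fix w assume w: "w \<in> W"
    show "((\<lambda>k. d (f k) (word_value (G (f k)) (case_sum (a (f k)) (g k)) w) \<one>\<^bsub>G (f k)\<^esub>) \<longlongrightarrow> 0) \<omega>"
      using presented_group_relation[OF W_subset group_metric_ultraproduct hom w]
        word_value_approximate_solution_iff[where g = g, OF f g w \<theta>a gx] by simp
  qed (use g gx in auto)
qed

lemma ultraclass_eq_if_eventually_eq:
  assumes f: "f \<in> UNIV \<rightarrow> I"
    and g: "\<And>k. g k \<in> carrier (G (f k))" and h: "\<And>k. h k \<in> carrier (G (f k))"
    and eq: "\<forall>\<^sub>F k in \<omega>. g k = h k"
  shows "ultraclass \<omega> (\<lambda>k. G (f k)) (\<lambda>k. d (f k)) g = ultraclass \<omega> (\<lambda>k. G (f k)) (\<lambda>k. d (f k)) h"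
proof -
  interpret metric_group_sequence "\<lambda>k. G (f k)" "\<lambda>k. d (f k)" \<omega>
    using f by (rule metric_group_sequence_reindex)
  have "\<forall>\<^sub>F k in \<omega>. d (f k) (g k) (h k) = 0"
    using eq by (rule eventually_mono) (use h Metric_space.mdist_zero[OF metric_H] in auto)
  then show ?thesis
    using ultraclass_eq_iff[OF g h] by (simp add: tendsto_eventually)
qed

text \<open>The sum of the \<open>m\<close> distances serves as a single measure of closeness to \<open>g k\<close>, to be
  nearly minimized over the exact solutions.\<close>

lemma stable_imp_liftable_ae:
  assumes stable: "constraint_stable I G d m W a"
    and \<omega>: "nonprincipal_ultrafilter \<omega>" and f: "f \<in> UNIV \<rightarrow> I"
    and \<theta>: "constraint_hom G d l m W a \<omega> f \<theta>"
  shows "constraint_liftable_ae G d l m W a \<omega> f \<theta>"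
proof -
  interpret metric_group_sequence "\<lambda>k. G (f k)" "\<lambda>k. d (f k)" \<omega>
    using f by (rule metric_group_sequence_reindex)
  obtain g where g: "\<And>k j. j < m \<Longrightarrow> g k j \<in> carrier (G (f k))"
    and \<theta>x: "\<And>j. j < m \<Longrightarrow> \<theta> (presented_gen l m W (Inr j)) =
      ultraclass \<omega> (\<lambda>k. G (f k)) (\<lambda>k. d (f k)) (\<lambda>k. g k j)"
    and lim: "\<And>w. w \<in> W \<Longrightarrow>
      ((\<lambda>k. d (f k) (word_value (G (f k)) (case_sum (a (f k)) (g k)) w) \<one>\<^bsub>G (f k)\<^esub>) \<longlongrightarrow> 0) \<omega>"
    using hom_gives_approximate_solutions[OF f \<theta>] by blast
  have delta: "\<forall>\<^sub>F k in \<omega>. delta_solution (G (f k)) (d (f k)) \<delta> m W (a (f k)) (g k)"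
    if "0 < \<delta>" for \<delta>
  proof -
    have "\<forall>\<^sub>F k in \<omega>. \<forall>w\<in>W.
        d (f k) (word_value (G (f k)) (case_sum (a (f k)) (g k)) w) \<one>\<^bsub>G (f k)\<^esub> < \<delta>"
      using finite_W order_tendstoD(2)[OF lim that] by (intro eventually_ball_finite) auto
    then show ?thesis
      by (rule eventually_mono) (simp add: delta_solution_def g)
  qed
  define r where "r k h = (\<Sum>j<m. d (f k) (g k j) (h j))" for k h
  have nonneg: "0 \<le> d (f k) x y" for k x y
    using metric_H[of k] by (rule Metric_space.nonneg)
  have "\<forall>\<^sub>F k in \<omega>. \<exists>h. solution (G (f k)) m W (a (f k)) h \<and> r k h < \<epsilon>" if "0 < \<epsilon>" for \<epsilon>
  proof -
    \<comment> \<open>dividing by \<open>m + 1\<close> keeps the sum of the \<open>m\<close> distances strictly below \<open>\<epsilon>\<close>, also for \<open>m = 0\<close>\<close>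
    have "0 < \<epsilon> / (m + 1)"
      using that by simp
    then obtain \<delta> where "0 < \<delta>"
      and \<delta>: "\<And>\<alpha> h. \<alpha> \<in> I \<Longrightarrow> delta_solution (G \<alpha>) (d \<alpha>) \<delta> m W (a \<alpha>) h \<Longrightarrow>
        \<exists>h'. solution (G \<alpha>) m W (a \<alpha>) h' \<and> (\<forall>j<m. d \<alpha> (h j) (h' j) < \<epsilon> / (m + 1))"
      using stable unfolding constraint_stable_def by meson
    show ?thesis
      using delta[OF \<open>0 < \<delta>\<close>]
    proof eventually_elim
      case (elim k)
      then obtain h where h: "solution (G (f k)) m W (a (f k)) h"
        and close: "\<And>j. j < m \<Longrightarrow> d (f k) (g k j) (h j) < \<epsilon> / (m + 1)"
        using \<delta>[of "f k" "g k"] f by blast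
      have "r k h \<le> (\<Sum>j<m. \<epsilon> / (m + 1))"
        unfolding r_def using close by (intro sum_mono) (simp add: less_imp_le)
      also have "\<dots> < \<epsilon>"
        using that by (simp add: field_simps)
      finally show ?case
        using h by blast
    qed
  qed
  moreover have "0 \<le> r k h" for k h
    by (simp add: r_def nonneg sum_nonneg)
  ultimately obtain h where sol: "\<forall>\<^sub>F k in \<omega>. solution (G (f k)) m W (a (f k)) (h k)"
    and r: "((\<lambda>k. r k (h k)) \<longlongrightarrow> 0) \<omega>"
    using near_minimizers_tendsto[OF nonprincipal_ultrafilter_le_sequentially[OF \<omega>], of r
        "\<lambda>k h. solution (G (f k)) m W (a (f k)) h"] by blast
  define h' where "h' k = (if solution (G (f k)) m W (a (f k)) (h k) then h k else g k)" for k
  have h': "h' k j \<in> carrier (G (f k))" if "j < m" for k j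
    using that g by (auto simp: h'_def solution_def)
  have "\<theta> (presented_gen l m W (Inr j)) =
      ultraclass \<omega> (\<lambda>k. G (f k)) (\<lambda>k. d (f k)) (\<lambda>k. h' k j)" if "j < m" for j
  proof -
    have "d (f k) (g k j) (h' k j) \<le> r k (h k)" for k
    proof (cases "solution (G (f k)) m W (a (f k)) (h k)")
      case True
      then show ?thesis
        using that by (auto simp: h'_def r_def nonneg
            intro!: member_le_sum[of j "{..<m}" "\<lambda>j. d (f k) (g k j) (h k j)"])
    next
      case False
      then show ?thesis
        using g[OF that] Metric_space.mdist_zero[OF metric_H[of k]]
        by (simp add: h'_def r_def nonneg sum_nonneg)
    qed
    then have "((\<lambda>k. d (f k) (g k j) (h' k j)) \<longlongrightarrow> 0) \<omega>"
      by (intro tendsto_sandwich[OF _ _ tendsto_const r]) (auto simp: nonneg)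
    then show ?thesis
      using \<theta>x[OF that] ultraclass_eq_iff[of "\<lambda>k. g k j" "\<lambda>k. h' k j"] g h' that by simp
  qed
  moreover have "\<forall>\<^sub>F k in \<omega>. solution (G (f k)) m W (a (f k)) (h' k)"
    using sol by (rule eventually_mono) (simp add: h'_def)
  ultimately show ?thesis
    unfolding constraint_liftable_ae_def using h' by blast
qed

lemma liftable_imp_liftable_ae:
  assumes "constraint_liftable G d l m W a \<omega> f \<theta>"
  shows "constraint_liftable_ae G d l m W a \<omega> f \<theta>"
proof -
  obtain g where "\<And>k. solution (G (f k)) m W (a (f k)) (g k)"
    "\<forall>j<m. \<theta> (presented_gen l m W (Inr j)) =
      ultraclass \<omega> (\<lambda>k. G (f k)) (\<lambda>k. d (f k)) (\<lambda>k. g k j)"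
    using assms unfolding constraint_liftable_def by blast
  then show ?thesis
    unfolding constraint_liftable_ae_def by (intro exI[of _ g]) (auto simp: solution_def)
qed

text \<open>Replacing the lift by arbitrary solutions on an \<open>\<omega>\<close>-null set of indices does not change the
  classes of its entries.\<close>

lemma liftable_ae_imp_liftable:
  assumes f: "f \<in> UNIV \<rightarrow> I" and lift: "constraint_liftable_ae G d l m W a \<omega> f \<theta>"
    and solvable: "\<And>k. \<exists>h. solution (G (f k)) m W (a (f k)) h"
  shows "constraint_liftable G d l m W a \<omega> f \<theta>"
proof -
  obtain g where g: "\<And>k j. j < m \<Longrightarrow> g k j \<in> carrier (G (f k))"
    and sol: "\<forall>\<^sub>F k in \<omega>. solution (G (f k)) m W (a (f k)) (g k)"
    and \<theta>x: "\<And>j. j < m \<Longrightarrow> \<theta> (presented_gen l m W (Inr j)) =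
      ultraclass \<omega> (\<lambda>k. G (f k)) (\<lambda>k. d (f k)) (\<lambda>k. g k j)"
    using lift unfolding constraint_liftable_ae_def by blast
  obtain h where h: "\<And>k. solution (G (f k)) m W (a (f k)) (h k)"
    using solvable by metis
  define g' where "g' k = (if solution (G (f k)) m W (a (f k)) (g k) then g k else h k)" for k
  have g': "solution (G (f k)) m W (a (f k)) (g' k)" for k
    using h by (simp add: g'_def)
  have "\<theta> (presented_gen l m W (Inr j)) =
      ultraclass \<omega> (\<lambda>k. G (f k)) (\<lambda>k. d (f k)) (\<lambda>k. g' k j)" if "j < m" for j
  proof -
    have "\<forall>\<^sub>F k in \<omega>. g k j = g' k j"
      using sol by (rule eventually_mono) (simp add: g'_def)
    then show ?thesis
      using \<theta>x[OF that] ultraclass_eq_if_eventually_eq[OF f, of "\<lambda>k. g k j" "\<lambda>k. g' k j"] g g' that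
      by (simp add: solution_def)
  qed
  then show ?thesis
    unfolding constraint_liftable_def using g' by blast
qed

text \<open>The counterexamples to stability for the tolerances \<open>1 / Suc k\<close> form a sequence of approximate
  solutions. The lift of the resulting homomorphism comes \<open>\<epsilon>\<close>-close to it for almost every \<open>k\<close>, and
  one such \<open>k\<close> suffices for a contradiction.\<close>

lemma liftable_ae_imp_stable:
  assumes lift: "\<And>\<omega> f \<theta>. nonprincipal_ultrafilter \<omega> \<Longrightarrow> f \<in> UNIV \<rightarrow> I \<Longrightarrow>
      constraint_hom G d l m W a \<omega> f \<theta> \<Longrightarrow> constraint_liftable_ae G d l m W a \<omega> f \<theta>"
  shows "constraint_stable I G d m W a"
proof (rule ccontr)
  assume "\<not> constraint_stable I G d m W a"
  then obtain \<epsilon> where "0 < \<epsilon>" and unstable: "\<And>\<delta>. 0 < \<delta> \<Longrightarrow>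
      \<exists>\<alpha>\<in>I. \<exists>g. delta_solution (G \<alpha>) (d \<alpha>) \<delta> m W (a \<alpha>) g \<and>
        \<not> (\<exists>g'. solution (G \<alpha>) m W (a \<alpha>) g' \<and> (\<forall>j<m. d \<alpha> (g j) (g' j) < \<epsilon>))"
    unfolding constraint_stable_def by metis
  have "\<exists>\<alpha> g. \<alpha> \<in> I \<and> delta_solution (G \<alpha>) (d \<alpha>) (1 / Suc k) m W (a \<alpha>) g \<and>
        \<not> (\<exists>g'. solution (G \<alpha>) m W (a \<alpha>) g' \<and> (\<forall>j<m. d \<alpha> (g j) (g' j) < \<epsilon>))" for k :: nat
    using unstable[of "1 / Suc k"] by auto
  then obtain f g where f: "f \<in> UNIV \<rightarrow> I"
    and delta: "\<And>k. delta_solution (G (f k)) (d (f k)) (1 / Suc k) m W (a (f k)) (g k)"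
    and far: "\<And>k g'. solution (G (f k)) m W (a (f k)) g' \<Longrightarrow>
      \<not> (\<forall>j<m. d (f k) (g k j) (g' j) < \<epsilon>)"
    unfolding Pi_iff by metis
  obtain \<omega> where \<omega>: "nonprincipal_ultrafilter \<omega>"
    using nonprincipal_ultrafilter_exists by blast
  interpret metric_group_sequence "\<lambda>k. G (f k)" "\<lambda>k. d (f k)" \<omega>
    using f by (rule metric_group_sequence_reindex)
  have g: "g k j \<in> carrier (G (f k))" if "j < m" for k j
    using delta that by (simp add: delta_solution_def)
  have inverse_lim: "((\<lambda>k. 1 / Suc k) \<longlongrightarrow> (0 :: real)) \<omega>"
    using LIMSEQ_Suc[OF lim_1_over_n] nonprincipal_ultrafilter_le_sequentially[OF \<omega>]
    by (rule tendsto_mono[rotated])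
  have "((\<lambda>k. d (f k) (word_value (G (f k)) (case_sum (a (f k)) (g k)) w) \<one>\<^bsub>G (f k)\<^esub>) \<longlongrightarrow> 0) \<omega>"
    if "w \<in> W" for w
  proof (rule tendsto_sandwich[OF _ _ tendsto_const inverse_lim])
    show "\<forall>\<^sub>F k in \<omega>. d (f k) (word_value (G (f k)) (case_sum (a (f k)) (g k)) w) \<one>\<^bsub>G (f k)\<^esub>
        \<le> 1 / Suc k"
      using that delta by (intro always_eventually allI less_imp_le) (simp add: delta_solution_def)
  qed (simp add: Metric_space.nonneg[OF metric_H])
  then obtain \<theta> where \<theta>: "constraint_hom G d l m W a \<omega> f \<theta>"
    and \<theta>x: "\<And>j. j < m \<Longrightarrow> \<theta> (presented_gen l m W (Inr j)) =
      ultraclass \<omega> (\<lambda>k. G (f k)) (\<lambda>k. d (f k)) (\<lambda>k. g k j)"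
    using approximate_solutions_give_hom[where g = g, OF f g] by blast
  obtain g' where g': "\<And>k j. j < m \<Longrightarrow> g' k j \<in> carrier (G (f k))"
    and sol: "\<forall>\<^sub>F k in \<omega>. solution (G (f k)) m W (a (f k)) (g' k)"
    and \<theta>x': "\<And>j. j < m \<Longrightarrow> \<theta> (presented_gen l m W (Inr j)) =
      ultraclass \<omega> (\<lambda>k. G (f k)) (\<lambda>k. d (f k)) (\<lambda>k. g' k j)"
    using lift[OF \<omega> f \<theta>] unfolding constraint_liftable_ae_def by blast
  have "\<forall>\<^sub>F k in \<omega>. d (f k) (g k j) (g' k j) < \<epsilon>" if "j < m" for j
  proof -
    have "((\<lambda>k. d (f k) (g k j) (g' k j)) \<longlongrightarrow> 0) \<omega>"
      using \<theta>x[OF that] \<theta>x'[OF that] ultraclass_eq_iff[of "\<lambda>k. g k j" "\<lambda>k. g' k j"] g g' that by simp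
    then show ?thesis
      using \<open>0 < \<epsilon>\<close> by (rule order_tendstoD)
  qed
  then have "\<forall>\<^sub>F k in \<omega>. \<forall>j\<in>{..<m}. d (f k) (g k j) (g' k j) < \<epsilon>"
    by (intro eventually_ball_finite) auto
  with sol have "\<forall>\<^sub>F k in \<omega>. False"
    by eventually_elim (use far in auto)
  then show False
    using \<omega> by (simp add: nonprincipal_ultrafilter_def trivial_limit_def)
qed

end

theorem theorem2p16:
  fixes I :: "'i set"
    and G :: "'i \<Rightarrow> ('g, 'b) monoid_scheme"
    and d :: "'i \<Rightarrow> 'g \<Rightarrow> 'g \<Rightarrow> real"
    and eps :: "'i \<Rightarrow> real"
    and l m :: nat
    and a :: "'i \<Rightarrow> nat \<Rightarrow> 'g"
    and W :: "(nat + nat) word set"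
  assumes "approximating_family I G d eps"
    and "1 \<le> m"
    and "\<And>\<alpha> i. \<alpha> \<in> I \<Longrightarrow> i < l \<Longrightarrow> a \<alpha> i \<in> carrier (G \<alpha>)"
    and "finite W"
    and "W \<subseteq> carrier (free_product l m)"
  shows "(((\<exists>\<alpha>\<in>I. \<exists>h. solution (G \<alpha>) m W (a \<alpha>) h) \<longrightarrow> (\<forall>\<alpha>\<in>I. \<exists>h. solution (G \<alpha>) m W (a \<alpha>) h)) \<longrightarrow>
      (constraint_stable I G d m W a \<longleftrightarrow>
        (\<forall>\<omega> f \<theta>. nonprincipal_ultrafilter \<omega> \<longrightarrow> f \<in> UNIV \<rightarrow> I \<longrightarrow>
          constraint_hom G d l m W a \<omega> f \<theta> \<longrightarrow> constraint_liftable G d l m W a \<omega> f \<theta>))) \<and>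
    (constraint_stable I G d m W a \<longleftrightarrow>
        (\<forall>\<omega> f \<theta>. nonprincipal_ultrafilter \<omega> \<longrightarrow> f \<in> UNIV \<rightarrow> I \<longrightarrow>
          constraint_hom G d l m W a \<omega> f \<theta> \<longrightarrow> constraint_liftable_ae G d l m W a \<omega> f \<theta>))"
proof -
  interpret metric_group_family_with_system I G d l m a W
  proof (rule metric_group_family_with_system.intro)
    fix \<alpha> assume "\<alpha> \<in> I"
    then show "bi_invariant_metric_group (G \<alpha>) (d \<alpha>)"
      using assms(1) unfolding approximating_family_def
      by (simp add: bi_invariant_metric_group_def bi_invariant_metric_group_axioms_def)
  qed (use assms in auto)
  have ae: "constraint_stable I G d m W a \<longleftrightarrow>
      (\<forall>\<omega> f \<theta>. nonprincipal_ultrafilter \<omega> \<longrightarrow> f \<in> UNIV \<rightarrow> I \<longrightarrow>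
        constraint_hom G d l m W a \<omega> f \<theta> \<longrightarrow> constraint_liftable_ae G d l m W a \<omega> f \<theta>)"
    using stable_imp_liftable_ae liftable_ae_imp_stable by blast
  have "constraint_liftable G d l m W a \<omega> f \<theta>"
    if solvable: "(\<exists>\<alpha>\<in>I. \<exists>h. solution (G \<alpha>) m W (a \<alpha>) h) \<longrightarrow>
        (\<forall>\<alpha>\<in>I. \<exists>h. solution (G \<alpha>) m W (a \<alpha>) h)"
      and \<omega>: "nonprincipal_ultrafilter \<omega>" and f: "f \<in> UNIV \<rightarrow> I"
      and lift: "constraint_liftable_ae G d l m W a \<omega> f \<theta>" for \<omega> f \<theta>
  proof (rule liftable_ae_imp_liftable[OF f lift])
    obtain g where "\<forall>\<^sub>F k in \<omega>. solution (G (f k)) m W (a (f k)) (g k)"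
      using lift unfolding constraint_liftable_ae_def by blast
    then have "\<exists>k. solution (G (f k)) m W (a (f k)) (g k)"
      using \<omega> eventually_happens' unfolding nonprincipal_ultrafilter_def by blast
    then show "\<exists>h. solution (G (f k)) m W (a (f k)) h" for k
      using solvable f by blast
  qed
  then show ?thesis
    using ae liftable_imp_liftable_ae by blast
qed

end
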